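(* Let $d\ge1$, let $(e_1,\dots,e_d)$ be the canonical basis of $\mathbb{R}^d$, let $c=(c_1,\dots,c_d)\in\mathbb{R}^d\setminus\{0\}$, and let $$\mu=\delta_c+\delta_{-c}+\sum_{i=1}^d\big(\delta_{e_i}+\delta_{-e_i}\big).$$ Then $\mu$ satisfies the Liouville property if and only if $1,c_1,\dots,c_d$ are linearly independent over $\mathbb{Q}$.
   Context: $\delta_a$ denotes the Dirac measure at $a$. For this finite symmetric measure $\mu$ on $\mathbb{R}^d\setminus\{0\}$, define $$\mathcal{L}^\mu[\psi](x)=\int_{\mathbb{R}^d\setminus\{0\}}\big(\psi(x+z)-\psi(x)\big)\,\mathrm{d}\mu(z).$$ For $u\in L^\infty(\mathbb{R}^d)$, "$\mathcal{L}^\mu[u]=0$ in $\mathcal{D}'(\mathbb{R}^d)$" means $\int_{\mathbb{R}^d}u(x)\,\mathcal{L}^\mu[\psi](x)\,\mathrm{d}x=0$ for all $\psi\in C_c^\infty(\mathbb{R}^d)$. The measure $\mu$ satisfies the Liouville property if every $u\in L^\infty(\mathbb{R}^d)$ with $\mathcal{L}^\mu[u]=0$ in $\mathcal{D}'(\mathbb{R}^d)$ is constant (almost everywhere). *)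

theory Defs
  imports "HOL-Analysis.Analysis" "HOL-Probability.Giry_Monad"
begin

text \<open>Since \<^term>\<open>frechet_derivative f (at x) v\<close> is the derivative of \<^term>\<open>f\<close> at \<^term>\<open>x\<close>
  in direction \<^term>\<open>v\<close>, the recursion says that all iterated directional derivatives up to
  order \<^term>\<open>k\<close> exist and are continuous.\<close>

primrec Ck :: "nat \<Rightarrow> ('a::euclidean_space \<Rightarrow> real) \<Rightarrow> bool" where
  "Ck 0 f \<longleftrightarrow> continuous_on UNIV f"
| "Ck (Suc k) f \<longleftrightarrow>
     (\<forall>x. f differentiable (at x)) \<and> (\<forall>v. Ck k (\<lambda>x. frechet_derivative f (at x) v))"

definition test_function :: "('a::euclidean_space \<Rightarrow> real) \<Rightarrow> bool" where
  "test_function \<psi> \<longleftrightarrow> (\<forall>k. Ck k \<psi>) \<and> compact (closure {x. \<psi> x \<noteq> 0})"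

text \<open>Functions are used in place of their almost-everywhere equivalence classes.\<close>

definition L_infinity :: "('a::euclidean_space \<Rightarrow> real) set" where
  "L_infinity = {u. u \<in> borel_measurable lebesgue \<and> (\<exists>C. AE x in lebesgue. \<bar>u x\<bar> \<le> C)}"

abbreviation punctured_borel :: "'a::euclidean_space measure" where
  "punctured_borel \<equiv> restrict_space borel (- {0})"

text \<open>In the following, \<^term>\<open>\<mu>\<close> is meant to be a measure on \<^term>\<open>punctured_borel\<close>.\<close>

definition levy_op :: "'a::euclidean_space measure \<Rightarrow> ('a \<Rightarrow> real) \<Rightarrow> 'a \<Rightarrow> real" where
  "levy_op \<mu> \<psi> x = (LINT z|\<mu>. \<psi> (x + z) - \<psi> x)"

definition levy_op_zero_distr :: "'a::euclidean_space measure \<Rightarrow> ('a \<Rightarrow> real) \<Rightarrow> bool" where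
  "levy_op_zero_distr \<mu> u \<longleftrightarrow>
     (\<forall>\<psi>. test_function \<psi> \<longrightarrow> (LINT x|lebesgue. u x * levy_op \<mu> \<psi> x) = 0)"

definition liouville_property :: "'a::euclidean_space measure \<Rightarrow> bool" where
  "liouville_property \<mu> \<longleftrightarrow>
     (\<forall>u \<in> L_infinity. levy_op_zero_distr \<mu> u \<longrightarrow> (\<exists>k. AE x in lebesgue. u x = k))"

abbreviation dirac :: "'a::euclidean_space \<Rightarrow> 'a measure" where
  "dirac a \<equiv> return punctured_borel a"

text \<open>The sum of measures, written out setwise; \<^term>\<open>axis i 1\<close> is the canonical basis vector.
  Coinciding atoms (when \<^term>\<open>c\<close> is plus or minus a basis vector) are counted with
  multiplicity.\<close>

definition mu :: "real ^ 'n \<Rightarrow> (real ^ 'n) measure" where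
  "mu c = measure_of (- {0}) (sets punctured_borel)
     (\<lambda>A. emeasure (dirac c) A + emeasure (dirac (- c)) A
        + (\<Sum>i\<in>UNIV. emeasure (dirac (axis i 1)) A + emeasure (dirac (- axis i 1)) A))"

lemma
  fixes c :: "real ^ 'n"
  shows space_mu [simp]: "space (mu c) = - {0}"
    and sets_mu [simp]: "sets (mu c) = sets punctured_borel"
proof -
  have *: "sets punctured_borel \<subseteq> Pow (- {0 :: real ^ 'n})"
    using sets.space_closed[of "punctured_borel :: (real ^ 'n) measure"]
    by (simp add: space_restrict_space)
  have **: "sigma_sets (- {0}) (sets punctured_borel) = sets (punctured_borel :: (real ^ 'n) measure)"
    using sets.sigma_sets_eq[of "punctured_borel :: (real ^ 'n) measure"]
    by (simp add: space_restrict_space)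
  show "space (mu c) = - {0}" "sets (mu c) = sets punctured_borel"
    unfolding mu_def by (simp_all only: space_measure_of[OF *] sets_measure_of[OF *] **)
qed

lemma emeasure_mu:
  fixes c :: "real ^ 'n"
  assumes "A \<in> sets punctured_borel"
  shows "emeasure (mu c) A = emeasure (dirac c) A + emeasure (dirac (- c)) A
    + (\<Sum>i\<in>UNIV. emeasure (dirac (axis i 1)) A + emeasure (dirac (- axis i 1)) A)"
proof (rule emeasure_measure_of[OF mu_def])
  show "sets punctured_borel \<subseteq> Pow (- {0 :: real ^ 'n})"
    using sets.space_closed[of "punctured_borel :: (real ^ 'n) measure"]
    by (simp add: space_restrict_space)
  show "A \<in> sets (mu c)"
    using assms by simp
  show "positive (sets (mu c)) (\<lambda>A. emeasure (dirac c) A + emeasure (dirac (- c)) A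
    + (\<Sum>i\<in>UNIV. emeasure (dirac (axis i 1)) A + emeasure (dirac (- axis i 1)) A))"
    by (simp add: positive_def)
  show "countably_additive (sets (mu c)) (\<lambda>A. emeasure (dirac c) A + emeasure (dirac (- c)) A
    + (\<Sum>i\<in>UNIV. emeasure (dirac (axis i 1)) A + emeasure (dirac (- axis i 1)) A))"
  proof (rule countably_additiveI)
    fix F :: "nat \<Rightarrow> (real ^ 'n) set"
    assume F: "range F \<subseteq> sets (mu c)" "disjoint_family F"
    have s: "(\<Sum>j. emeasure (dirac a) (F j)) = emeasure (dirac a) (\<Union> (range F))" for a
      using F by (intro suminf_emeasure) auto
    have "(\<Sum>j. \<Sum>i\<in>UNIV. emeasure (dirac (axis i 1)) (F j) + emeasure (dirac (- axis i 1)) (F j))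
       = (\<Sum>i\<in>UNIV. \<Sum>j. emeasure (dirac (axis i 1)) (F j) + emeasure (dirac (- axis i 1)) (F j))"
      by (rule suminf_sum) (rule summableI)
    then show "(\<Sum>j. emeasure (dirac c) (F j) + emeasure (dirac (- c)) (F j)
          + (\<Sum>i\<in>UNIV. emeasure (dirac (axis i 1)) (F j) + emeasure (dirac (- axis i 1)) (F j)))
       = emeasure (dirac c) (\<Union> (range F)) + emeasure (dirac (- c)) (\<Union> (range F))
          + (\<Sum>i\<in>UNIV. emeasure (dirac (axis i 1)) (\<Union> (range F))
               + emeasure (dirac (- axis i 1)) (\<Union> (range F)))"
      by (simp add: suminf_add[symmetric] summableI s)
  qed
qed

interpretation rat_real: vector_space "\<lambda>(q::rat) (x::real). of_rat q * x"
  by unfold_locales (simp_all add: algebra_simps of_rat_add of_rat_mult)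

text \<open>Independence of a family rather than of its range: repeated values make it dependent.\<close>

definition rat_independent_family :: "('i \<Rightarrow> real) \<Rightarrow> bool" where
  "rat_independent_family f \<longleftrightarrow> inj f \<and> rat_real.independent (range f)"

lemma rat_independent_family_iff:
  fixes f :: "'i::finite \<Rightarrow> real"
  shows "rat_independent_family f \<longleftrightarrow>
    (\<forall>q :: 'i \<Rightarrow> rat. (\<Sum>i\<in>UNIV. of_rat (q i) * f i) = 0 \<longrightarrow> (\<forall>i. q i = 0))"
proof
  assume *: "rat_independent_family f"
  show "\<forall>q :: 'i \<Rightarrow> rat. (\<Sum>i\<in>UNIV. of_rat (q i) * f i) = 0 \<longrightarrow> (\<forall>i. q i = 0)"
  proof (intro allI impI)
    fix q :: "'i \<Rightarrow> rat" and i
    assume q: "(\<Sum>i\<in>UNIV. of_rat (q i) * f i) = 0"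
    have f: "inj f" and ind: "rat_real.independent (range f)"
      using * by (auto simp: rat_independent_family_def)
    have "(\<Sum>v\<in>range f. of_rat (q (inv f v)) * v) = 0"
      using q f by (simp add: sum.reindex)
    from rat_real.independentD[OF ind _ _ this, of "f i"] show "q i = 0"
      using f by simp
  qed
next
  assume *: "\<forall>q :: 'i \<Rightarrow> rat. (\<Sum>i\<in>UNIV. of_rat (q i) * f i) = 0 \<longrightarrow> (\<forall>i. q i = 0)"
  have f: "inj f"
  proof (rule injI, rule ccontr)
    fix i j assume ij: "f i = f j" "i \<noteq> j"
    define q :: "'i \<Rightarrow> rat" where "q k = (if k = i then 1 else 0) - (if k = j then 1 else 0)" for k
    have "of_rat (q k) * f k = (if k = i then f k else 0) - (if k = j then f k else 0)" for k
      by (simp add: q_def of_rat_diff of_rat_minus)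
    then have "(\<Sum>k\<in>UNIV. of_rat (q k) * f k) = f i - f j"
      by (simp add: sum_subtractf)
    with * ij have "q i = 0" by simp
    with ij show False by (simp add: q_def)
  qed
  have "rat_real.independent (range f)"
  proof
    assume "rat_real.dependent (range f)"
    then obtain u where u: "\<exists>v\<in>range f. u v \<noteq> 0" "(\<Sum>v\<in>range f. of_rat (u v) * v) = 0"
      by (subst (asm) rat_real.dependent_finite) auto
    then have "(\<Sum>i\<in>UNIV. of_rat (u (f i)) * f i) = 0"
      using f by (simp add: sum.reindex)
    with * have "\<forall>i. u (f i) = 0" by (elim allE[of _ "\<lambda>i. u (f i)"]) auto
    with u show False by auto
  qed
  with f show "rat_independent_family f" by (simp add: rat_independent_family_def)
qed

end

theory Submission
  imports Defs
begin

text \<open>Let \<open>g\<^sub>j\<close> run through \<open>c\<close> and the basis vectors. Pairing a solution \<open>u\<close> with the translates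
  of a test function gives a bounded continuous \<open>F\<close> that is harmonic for the simple random walk with
  steps \<open>\<plusminus>g\<^sub>j\<close>. If some increment \<open>F (x + g\<^sub>j) - F x\<close> were positive, then near the supremum of these
  increments it would stay large along \<open>x, x + g\<^sub>j, x + 2g\<^sub>j, \<dots>\<close>, and summing contradicts the
  boundedness of \<open>F\<close>; so \<open>F\<close> is invariant under the group generated by the \<open>g\<^sub>j\<close>. In the independent
  case this group is dense by Kronecker's theorem, so \<open>F\<close> is constant, hence \<open>u\<close> is translation
  invariant. Conversely, an integer relation \<open>m \<bullet> c \<in> \<int>\<close> with \<open>m \<noteq> 0\<close> makes \<open>cos (2\<pi> m \<bullet> x)\<close> a
  nonconstant solution.\<close>

section \<open>Smooth functions\<close>

text \<open>\<open>frechet_derivative\<close> is defined by choice; uniqueness of derivatives allows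
  any explicit candidate \<open>D\<close> to take its place in the recursion.\<close>

lemma Ck_SucI:
  assumes "\<And>x. (f has_derivative D x) (at x)" and "\<And>v. Ck k (\<lambda>x. D x v)"
  shows "Ck (Suc k) f"
proof -
  have "frechet_derivative f (at x) = D x" for x
    using frechet_derivative_at[OF assms(1)[of x]] by simp
  with assms show ?thesis
    by (auto simp: differentiable_def)
qed

lemma Ck_Suc_has_derivative:
  assumes "Ck (Suc k) f"
  shows "(f has_derivative frechet_derivative f (at x)) (at x)"
  using assms by (simp add: frechet_derivative_works)

lemma Ck_SucD: "Ck (Suc k) f \<Longrightarrow> Ck k f"
proof (induction k arbitrary: f)
  case 0
  then show ?case
    by (auto intro!: continuous_at_imp_continuous_on differentiable_imp_continuous_within)
next
  case (Suc k)
  then show ?case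
    by (metis Ck.simps(2))
qed

lemma Ck_imp_continuous: "Ck k f \<Longrightarrow> continuous_on UNIV f"
  by (induction k) (use Ck_SucD in auto)

lemma Ck_const: "Ck k (\<lambda>x. a)"
proof (induction k arbitrary: a)
  case (Suc k)
  show ?case
    by (rule Ck_SucI[OF has_derivative_const Suc])
qed auto

lemma Ck_inner_left: "Ck k (\<lambda>x. x \<bullet> b)"
proof (cases k)
  case (Suc j)
  have "((\<lambda>x. x \<bullet> b) has_derivative (\<lambda>v. v \<bullet> b)) (at x)" for x
    by (auto intro!: derivative_eq_intros)
  then show ?thesis
    unfolding Suc by (rule Ck_SucI[OF _ Ck_const])
qed (auto intro!: continuous_intros)

lemma Ck_add: "Ck k f \<Longrightarrow> Ck k g \<Longrightarrow> Ck k (\<lambda>x. f x + g x)"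
proof (induction k arbitrary: f g)
  case (Suc k)
  show ?case
    by (rule Ck_SucI[OF has_derivative_add[OF Suc.prems[THEN Ck_Suc_has_derivative]]])
      (use Suc in auto)
qed (auto intro!: continuous_intros)

lemma Ck_mult: "Ck k f \<Longrightarrow> Ck k g \<Longrightarrow> Ck k (\<lambda>x. f x * g x)"
proof (induction k arbitrary: f g)
  case (Suc k)
  show ?case
    by (rule Ck_SucI[OF has_derivative_mult[OF Suc.prems[THEN Ck_Suc_has_derivative]]])
      (intro Ck_add Suc.IH Suc.prems[THEN Ck_SucD], use Suc.prems in auto)
qed (auto intro!: continuous_intros)

lemma Ck_prod:
  assumes "\<And>i. i \<in> I \<Longrightarrow> Ck k (f i)"
  shows "Ck k (\<lambda>x. \<Prod>i\<in>I. f i x)"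
proof (cases "finite I")
  case True
  then show ?thesis
    using assms by (induction I) (auto intro: Ck_const Ck_mult)
qed (auto intro: Ck_const)

text \<open>The outer function is given as a whole sequence of successive derivatives: the chain
  rule turns \<open>\<phi> n\<close> into \<open>\<phi> (Suc n)\<close>, so the induction on
  \<open>k\<close> closes once \<open>n\<close> is generalized.\<close>

lemma Ck_compose:
  assumes \<phi>: "\<And>n t. (\<phi> n has_real_derivative \<phi> (Suc n) t) (at t)"
  shows "Ck k f \<Longrightarrow> Ck k (\<lambda>x. \<phi> n (f x))"
proof (induction k arbitrary: n)
  case 0
  then show ?case
    using continuous_on_compose2[of UNIV "\<phi> n"] DERIV_continuous[OF \<phi>]
    by (metis Ck.simps(1) continuous_at_imp_continuous_on subset_UNIV)
next
  case (Suc k)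
  have "((\<lambda>x. \<phi> n (f x)) has_derivative (\<lambda>v. frechet_derivative f (at x) v * \<phi> (Suc n) (f x))) (at x)" for x
    using has_derivative_compose[OF Ck_Suc_has_derivative[OF Suc.prems] \<phi>[unfolded has_field_derivative_def]]
    by (simp add: mult.commute)
  then show ?case
    by (rule Ck_SucI) (intro Ck_mult Suc.IH Ck_SucD[OF Suc.prems], use Suc.prems in auto)
qed

text \<open>A family closed under differentiation that contains \<open>exp (-1/t)\<close>, extended by \<open>0\<close>.\<close>

definition poly_flat :: "real poly \<Rightarrow> real \<Rightarrow> real" where
  "poly_flat p t = (if t > 0 then poly p (inverse t) * exp (- inverse t) else 0)"

lemma tendsto_poly_div_exp_0: "((\<lambda>x. poly p x / exp x) \<longlongrightarrow> (0::real)) at_top"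
  unfolding poly_altdef sum_divide_distrib
  by (rule tendsto_null_sum) (use tendsto_mult_right_zero[OF tendsto_power_div_exp_0] in \<open>simp add: field_simps\<close>)

text \<open>For \<open>t > 0\<close>, differentiating p(1/t) exp(-1/t) gives t^(-2) (p - p')(1/t)
  exp(-1/t). Thus differentiation acts on the polynomial as p -> x^2 (p - p').\<close>

lemma DERIV_poly_flat:
  "(poly_flat p has_real_derivative poly_flat ([:0, 0, 1:] * (p - pderiv p)) t) (at t)"
proof -
  consider "t > 0" | "t < 0" | "t = 0" by linarith
  then show ?thesis
  proof cases
    case 1
    have "((\<lambda>t. poly p (inverse t) * exp (- inverse t)) has_real_derivative
        poly_flat ([:0, 0, 1:] * (p - pderiv p)) t) (at t)"
      using 1 by (auto intro!: derivative_eq_intros DERIV_chain2[OF poly_DERIV] simp: poly_flat_def power2_eq_square field_simps)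
    then show ?thesis
      by (rule DERIV_cong_ev[OF refl _ refl, THEN iffD1, rotated])
        (use eventually_nhds_in_open[of "{0<..}" t] 1 in \<open>auto simp: poly_flat_def elim: eventually_mono\<close>)
  next
    case 2
    have "((\<lambda>t. 0) has_real_derivative poly_flat ([:0, 0, 1:] * (p - pderiv p)) t) (at t)"
      using 2 by (simp add: poly_flat_def)
    then show ?thesis
      by (rule DERIV_cong_ev[OF refl _ refl, THEN iffD1, rotated])
        (use eventually_nhds_in_open[of "{..<0}" t] 2 in \<open>auto simp: poly_flat_def elim: eventually_mono\<close>)
  next
    case 3
    \<comment> \<open>Division by \<open>h\<close> in the difference quotient multiplies by the
      variable \<open>inverse h\<close>, which is the shift \<open>pCons 0 p\<close>; the
      exponential then wins as \<open>inverse h\<close> tends to infinity.\<close>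
    have "((\<lambda>h. poly (pCons 0 p) (inverse h) / exp (inverse h)) \<longlongrightarrow> 0) (at_right (0::real))"
      by (rule filterlim_compose[OF tendsto_poly_div_exp_0 filterlim_inverse_at_top_right])
    moreover have "\<forall>\<^sub>F h in at_right 0. poly (pCons 0 p) (inverse h) / exp (inverse h) = (poly_flat p (0 + h) - poly_flat p 0) / h"
      using eventually_at_right_less[of "0::real"]
      by eventually_elim (auto simp: poly_flat_def exp_minus field_simps)
    ultimately have "((\<lambda>h. (poly_flat p (0 + h) - poly_flat p 0) / h) \<longlongrightarrow> 0) (at_right 0)"
      by (rule Lim_transform_eventually)
    moreover have "\<forall>\<^sub>F h in at_left (0::real). 0 = (poly_flat p (0 + h) - poly_flat p 0) / h"
      by (auto simp: poly_flat_def eventually_at_filter)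
    then have "((\<lambda>h. (poly_flat p (0 + h) - poly_flat p 0) / h) \<longlongrightarrow> 0) (at_left 0)"
      by (rule Lim_transform_eventually[OF tendsto_const])
    ultimately have "((\<lambda>h. (poly_flat p (0 + h) - poly_flat p 0) / h) \<longlongrightarrow> 0) (at 0)"
      by (simp add: filterlim_at_split)
    with 3 show ?thesis
      by (simp add: DERIV_def poly_flat_def)
  qed
qed

lemma Ck_poly_flat: "Ck k f \<Longrightarrow> Ck k (\<lambda>x. poly_flat p (f x))"
  using Ck_compose[of "\<lambda>n. poly_flat (((\<lambda>p. [:0, 0, 1:] * (p - pderiv p)) ^^ n) p)" k f 0] DERIV_poly_flat
  by simp

lemma Ck_exp_minus: "Ck k f \<Longrightarrow> Ck k (\<lambda>x. exp (- f x))"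
proof -
  assume f: "Ck k f"
  have "((\<lambda>t. (- 1) ^ n * exp (- t)) has_real_derivative (- 1) ^ Suc n * exp (- t)) (at t)" for n t
    by (auto intro!: derivative_eq_intros)
  from Ck_compose[of "\<lambda>n t. (- 1) ^ n * exp (- t)" k f 0, OF this f] show ?thesis
    by simp
qed

lemma test_functions_tendsto_indicator_box:
  fixes l u :: "'a::euclidean_space"
  obtains \<psi> :: "nat \<Rightarrow> 'a \<Rightarrow> real" where
    "\<And>n. test_function (\<psi> n)" and "\<And>n x. \<bar>\<psi> n x\<bar> \<le> indicator (box l u) x"
    and "\<And>x. (\<lambda>n. \<psi> n x) \<longlonglongrightarrow> indicator (box l u) x"
proof
  text \<open>The smooth function \<open>g\<close> is positive exactly on the box, so \<open>1 - exp (-n g)\<close> tends to its indicator.\<close>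
  define g where "g x = (\<Prod>b\<in>Basis. poly_flat 1 (x \<bullet> b + - (l \<bullet> b)) * poly_flat 1 (x \<bullet> (- b) + u \<bullet> b))" for x
  define \<psi> where "\<psi> n x = 1 + (- 1) * exp (- (real n * g x))" for n x
  have g_pos: "g x > 0" if "x \<in> box l u" for x
    using that by (auto simp: g_def box_def poly_flat_def intro!: prod_pos)
  have g_zero: "g x = 0" if "x \<notin> box l u" for x
    using that by (fastforce simp: g_def box_def poly_flat_def)
  have \<psi>_zero: "\<psi> n x = 0" if "x \<notin> box l u" for n x
    using g_zero[OF that] by (simp add: \<psi>_def)
  \<comment> \<open>Differences in \<open>g\<close> and \<open>\<psi>\<close> were written as sums
    with negated terms, so that the closure rules below match syntactically.\<close>
  have "Ck k (\<psi> n)" for k n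
    unfolding \<psi>_def g_def
    by (intro Ck_add Ck_mult Ck_const Ck_exp_minus Ck_prod Ck_poly_flat Ck_inner_left)
  moreover have "bounded {x. \<psi> n x \<noteq> 0}" for n
    by (rule bounded_subset[OF bounded_box]) (use \<psi>_zero in auto)
  ultimately show "test_function (\<psi> n)" for n
    by (auto simp: test_function_def compact_closure)
  show "\<bar>\<psi> n x\<bar> \<le> indicator (box l u) x" for n x
    using g_pos[of x] \<psi>_zero[of x n] by (auto simp: \<psi>_def indicator_def)
  show "(\<lambda>n. \<psi> n x) \<longlonglongrightarrow> indicator (box l u) x" for x
  proof (cases "x \<in> box l u")
    case True
    have "filterlim (\<lambda>n. real n * g x) at_top sequentially"
      using g_pos[OF True] by (rule filterlim_at_top_mult_tendsto_pos[OF tendsto_const _ filterlim_real_sequentially])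
    then have "(\<lambda>n. exp (- (real n * g x))) \<longlonglongrightarrow> 0"
      by (intro filterlim_compose[OF exp_at_bot] filterlim_uminus_at_bot_at_top[THEN filterlim_compose])
    from tendsto_add[OF tendsto_const tendsto_mult_left[OF this], of 1 "-1"] show ?thesis
      using True by (simp add: \<psi>_def)
  qed (use \<psi>_zero in simp)
qed

section \<open>Test functions determine bounded functions\<close>

lemma test_function_continuous: "test_function \<psi> \<Longrightarrow> continuous_on UNIV \<psi>"
  by (auto simp: test_function_def intro: Ck_imp_continuous)

text \<open>One inequality records both boundedness and compact support, in the form needed for
  dominating functions.\<close>

lemma test_function_bounded:
  fixes \<psi> :: "'a::euclidean_space \<Rightarrow> real"
  assumes "test_function \<psi>"
  obtains K R where "\<And>x. \<bar>\<psi> x\<bar> \<le> K * indicator (cball 0 R) x"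
proof -
  define S where "S = closure {x. \<psi> x \<noteq> 0}"
  have "compact S"
    using assms by (simp add: S_def test_function_def)
  have "compact (\<psi> ` S)"
    using \<open>compact S\<close> test_function_continuous[OF assms]
    by (intro compact_continuous_image) (auto intro: continuous_on_subset)
  then obtain K where K: "\<And>x. x \<in> S \<Longrightarrow> \<bar>\<psi> x\<bar> \<le> K"
    using compact_imp_bounded[OF \<open>compact (\<psi> ` S)\<close>] unfolding bounded_iff by (metis image_eqI real_norm_def)
  obtain R where R: "S \<subseteq> cball 0 R"
    using bounded_subset_ballD[OF compact_imp_bounded[OF \<open>compact S\<close>], of 0] ball_subset_cball by blast
  have "\<psi> x = 0" if "x \<notin> S" for x
    using that closure_subset[of "{x. \<psi> x \<noteq> 0}"] by (auto simp: S_def)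
  \<comment> \<open>\<open>K\<close> may be negative when \<open>S\<close> is empty; the absolute
    value keeps the bound valid at points of the ball outside \<open>S\<close>.\<close>
  then have "\<bar>\<psi> x\<bar> \<le> \<bar>K\<bar> * indicator (cball 0 R) x" for x
    using K[of x] subsetD[OF R, of x] by (cases "x \<in> S") auto
  then show thesis by (rule that)
qed

lemma Ck_translate:
  fixes f :: "'a::euclidean_space \<Rightarrow> real"
  shows "Ck k f \<Longrightarrow> Ck k (\<lambda>x. f (x + a))"
proof (induction k arbitrary: f)
  case 0
  then show ?case
    by (auto intro!: continuous_intros continuous_on_compose2[of UNIV f])
next
  case (Suc k)
  have "((\<lambda>x. f (x + a)) has_derivative frechet_derivative f (at (x + a))) (at x)" for x
  proof -
    have "((\<lambda>x. x + a) has_derivative (\<lambda>v. v)) (at x)"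
      by (auto intro!: derivative_eq_intros)
    from has_derivative_compose[OF this Ck_Suc_has_derivative[OF Suc.prems]] show ?thesis by simp
  qed
  then show ?case
    by (rule Ck_SucI) (use Suc in auto)
qed

lemma test_function_translate:
  fixes \<psi> :: "'a::euclidean_space \<Rightarrow> real"
  assumes "test_function \<psi>"
  shows "test_function (\<lambda>x. \<psi> (x + a))"
proof -
  have "{x. \<psi> (x + a) \<noteq> 0} = (\<lambda>x. x - a) ` {x. \<psi> x \<noteq> 0}"
    by (auto simp: image_iff) (metis add_diff_cancel)
  moreover have "bounded {x. \<psi> x \<noteq> 0}"
    using assms by (simp add: test_function_def)
  ultimately have "bounded {x. \<psi> (x + a) \<noteq> 0}"
    using bounded_translation[of "{x. \<psi> x \<noteq> 0}" "- a"] by simp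
  then show ?thesis
    using assms by (auto simp: test_function_def intro: Ck_translate)
qed

lemma integrable_bounded_support:
  fixes f :: "'a::euclidean_space \<Rightarrow> real"
  assumes "f \<in> borel_measurable borel" and "\<And>x. \<bar>f x\<bar> \<le> K * indicator (cball a R) x"
  shows "integrable lborel f"
proof (rule Bochner_Integration.integrable_bound)
  show "integrable lborel (\<lambda>x. K * indicator (cball a R) x)"
    by (auto intro!: integrable_real_indicator emeasure_lborel_cball_finite)
  show "AE x in lborel. norm (f x) \<le> norm (K * indicator (cball a R) x :: real)"
    using assms(2) by (fastforce intro: order_trans[OF _ abs_ge_self])
qed (use assms(1) in simp)

lemma test_function_times_integrable:
  fixes u \<psi> :: "'a::euclidean_space \<Rightarrow> real"
  assumes [measurable]: "u \<in> borel_measurable borel" and u: "\<And>x. \<bar>u x\<bar> \<le> C"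
    and "test_function \<psi>"
  shows "integrable lborel (\<lambda>x. u x * \<psi> x)"
proof -
  obtain K R where K: "\<And>x. \<bar>\<psi> x\<bar> \<le> K * indicator (cball 0 R) x"
    using test_function_bounded[OF assms(3)] by blast
  have [measurable]: "\<psi> \<in> borel_measurable borel"
    by (rule borel_measurable_continuous_onI[OF test_function_continuous[OF assms(3)]])
  show ?thesis
  proof (rule integrable_bounded_support)
    show "\<bar>u x * \<psi> x\<bar> \<le> (C * K) * indicator (cball 0 R) x" for x
      using mult_mono[OF u[of x] K[of x]] u[of x] by (simp add: abs_mult mult.assoc)
  qed measurable
qed

lemma lborel_integral_translate:
  fixes f :: "'a::euclidean_space \<Rightarrow> real"
  assumes "f \<in> borel_measurable borel"
  shows "(LINT x|lborel. f (x + a)) = (LINT x|lborel. f x)"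
  using integral_distr[of "(+) a" lborel borel f] assms by (simp add: lborel_distr_plus add.commute)

text \<open>Adding \<open>C\<close> makes both functions nonnegative, hence densities of measures.
  These agree and are finite on boxes, an intersection-stable generator of the Borel sets, so the
  measures coincide and their densities agree almost everywhere.\<close>

lemma AE_eq_if_box_integrals_eq:
  fixes f g :: "'a::euclidean_space \<Rightarrow> real"
  assumes [measurable]: "f \<in> borel_measurable borel" "g \<in> borel_measurable borel"
    and f: "\<And>x. \<bar>f x\<bar> \<le> C" and g: "\<And>x. \<bar>g x\<bar> \<le> C"
    and eq: "\<And>l u. (LINT x|lborel. f x * indicator (box l u) x) = (LINT x|lborel. g x * indicator (box l u) x)"
  shows "AE x in lborel. f x = g x"
proof -
  have emeasure_box: "emeasure (density lborel (\<lambda>x. ennreal (h x + C))) (box l u)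
      = ennreal ((LINT x|lborel. h x * indicator (box l u) x) + C * measure lborel (box l u))"
    if [measurable]: "h \<in> borel_measurable borel" and h: "\<And>x. \<bar>h x\<bar> \<le> C" for h :: "'a \<Rightarrow> real" and l u
  proof -
    have box: "integrable lborel (indicator (box l u) :: 'a \<Rightarrow> real)"
      by (auto intro!: integrable_real_indicator emeasure_lborel_box_finite)
    have h_box: "integrable lborel (\<lambda>x. h x * indicator (box l u) x)"
    proof (rule Bochner_Integration.integrable_bound)
      show "integrable lborel (\<lambda>x. C * indicator (box l u) x)"
        using box by simp
      show "AE x in lborel. norm (h x * indicator (box l u) x) \<le> norm (C * indicator (box l u) x :: real)"
        using h by (auto simp: indicator_def intro: order_trans[OF _ abs_ge_self])
    qed simp
    have nonneg: "h x + C \<ge> 0" for x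
      using h[of x] by linarith
    have "emeasure (density lborel (\<lambda>x. ennreal (h x + C))) (box l u)
        = (\<integral>\<^sup>+ x. ennreal ((h x + C) * indicator (box l u) x) \<partial>lborel)"
      by (subst emeasure_density) (auto intro!: nn_integral_cong simp: indicator_def)
    also have "\<dots> = ennreal (LINT x|lborel. (h x + C) * indicator (box l u) x)"
    proof (rule nn_integral_eq_integral)
      show "integrable lborel (\<lambda>x. (h x + C) * indicator (box l u) x)"
        using h_box box by (simp add: distrib_right)
    qed (use nonneg in simp)
    also have "(LINT x|lborel. (h x + C) * indicator (box l u) x)
        = (LINT x|lborel. h x * indicator (box l u) x) + C * measure lborel (box l u)"
      using h_box box by (simp add: distrib_right)
    finally show ?thesis .
  qed
  have "density lborel (\<lambda>x. ennreal (f x + C)) = density lborel (\<lambda>x. ennreal (g x + C))" (is "?M = ?N")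
  proof (rule measure_eqI_generator_eq)
    let ?E = "range (\<lambda>(a, b). box a b :: 'a set)"
    show "Int_stable ?E"
      by (auto simp: Int_stable_def box_Int_box)
    show "?E \<subseteq> Pow UNIV" "sets ?M = sigma_sets UNIV ?E" "sets ?N = sigma_sets UNIV ?E"
      by (simp_all add: borel_eq_box)
    let ?A = "\<lambda>n::nat. box (- (real n *\<^sub>R One)) (real n *\<^sub>R One) :: 'a set"
    show "range ?A \<subseteq> ?E" "(\<Union>i. ?A i) = UNIV"
      unfolding UN_box_eq_UNIV by auto
    show "emeasure ?M (?A i) \<noteq> \<infinity>" for i
      using f by (simp add: emeasure_box)
    show "emeasure ?M X = emeasure ?N X" if "X \<in> ?E" for X
      using that f g by (auto simp: emeasure_box eq)
  qed
  then have "AE x in lborel. ennreal (f x + C) = ennreal (g x + C)"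
    by (intro sigma_finite_measure.density_unique[OF lborel.sigma_finite_measure_axioms]) auto
  then show ?thesis
  proof eventually_elim
    case (elim x)
    moreover have "f x + C \<ge> 0" "g x + C \<ge> 0"
      using f[of x] g[of x] by linarith+
    ultimately show ?case by simp
  qed
qed

text \<open>Since indicators of boxes are dominated pointwise limits of test functions, dominated
  convergence carries the equality from test functions to boxes.\<close>

lemma AE_eq_if_test_integrals_eq:
  fixes f g :: "'a::euclidean_space \<Rightarrow> real"
  assumes meas [measurable]: "f \<in> borel_measurable borel" "g \<in> borel_measurable borel"
    and f: "\<And>x. \<bar>f x\<bar> \<le> C" and g: "\<And>x. \<bar>g x\<bar> \<le> C"
    and eq: "\<And>\<psi>. test_function \<psi> \<Longrightarrow> (LINT x|lborel. f x * \<psi> x) = (LINT x|lborel. g x * \<psi> x)"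
  shows "AE x in lborel. f x = g x"
proof (rule AE_eq_if_box_integrals_eq[OF meas f g])
  fix l u :: 'a
  obtain \<psi> :: "nat \<Rightarrow> 'a \<Rightarrow> real" where
    test: "\<And>n. test_function (\<psi> n)" and le: "\<And>n x. \<bar>\<psi> n x\<bar> \<le> indicator (box l u) x"
    and lim: "\<And>x. (\<lambda>n. \<psi> n x) \<longlonglongrightarrow> indicator (box l u) x"
    using test_functions_tendsto_indicator_box by blast
  have [measurable]: "\<psi> n \<in> borel_measurable borel" for n
    by (rule borel_measurable_continuous_onI[OF test_function_continuous[OF test]])
  have conv: "(\<lambda>n. LINT x|lborel. h x * \<psi> n x) \<longlonglongrightarrow> (LINT x|lborel. h x * indicator (box l u) x)"
    if [measurable]: "h \<in> borel_measurable borel" and h: "\<And>x. \<bar>h x\<bar> \<le> C" for h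
  proof (rule integral_dominated_convergence)
    show "integrable lborel (\<lambda>x. C * indicator (box l u) x)"
      by (auto intro!: integrable_real_indicator emeasure_lborel_box_finite)
    show "AE x in lborel. norm (h x * \<psi> n x) \<le> C * indicator (box l u) x" for n
    proof (rule AE_I2)
      fix x
      have "C \<ge> 0"
        using h[of x] by linarith
      from mult_mono[OF h[of x] le[of n x] this]
      show "norm (h x * \<psi> n x) \<le> C * indicator (box l u) x"
        by (simp add: abs_mult)
    qed
    show "AE x in lborel. (\<lambda>n. h x * \<psi> n x) \<longlonglongrightarrow> h x * indicator (box l u) x"
      by (intro AE_I2 tendsto_mult_left lim)
  qed measurable
  show "(LINT x|lborel. f x * indicator (box l u) x) = (LINT x|lborel. g x * indicator (box l u) x)"
    using LIMSEQ_unique[OF conv[OF meas(1) f]] conv[OF meas(2) g] eq[OF test] by simp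
qed

section \<open>Translation invariance almost everywhere\<close>

lemma AE_lborel_translate:
  fixes P :: "'a::euclidean_space \<Rightarrow> bool"
  assumes [measurable]: "Measurable.pred borel P" and "AE x in lborel. P (a + x)"
  shows "AE x in lborel. P x"
proof -
  have "(AE x in distr lborel borel ((+) a). P x) \<longleftrightarrow> (AE x in lborel. P (a + x))"
    by (rule AE_distr_iff; measurable)
  with assms(2) show ?thesis
    unfolding lborel_distr_plus by simp
qed

text \<open>The exceptional null set depends on \<open>y\<close>. Fubini exchanges the two
  almost-everywhere quantifiers and yields a single \<open>x\<close> with
  \<open>u (x + y) = u x\<close> for almost every \<open>y\<close>; translating by \<open>x\<close>
  gives the constant \<open>u x\<close>.\<close>

lemma AE_const_if_translation_invariant:
  fixes u :: "'a::euclidean_space \<Rightarrow> real"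
  assumes [measurable]: "u \<in> borel_measurable borel"
    and "\<And>y. AE x in lborel. u (x + y) = u x"
  shows "\<exists>k. AE x in lborel. u x = k"
proof -
  have "AE y in lborel. AE x in lborel. u (x + y) = u x"
    using assms(2) by simp
  moreover have "{z \<in> space (lborel \<Otimes>\<^sub>M lborel). u (snd z + fst z) = u (snd z)} \<in> sets (lborel \<Otimes>\<^sub>M lborel)"
    by measurable
  ultimately have "AE x in lborel. AE y in lborel. u (x + y) = u x"
    by (subst (asm) lborel_pair.AE_commute) auto
  then obtain x where "AE y in lborel. u (x + y) = u x"
    using eventually_happens'[of "ae_filter lborel"] by (auto simp: ae_filter_eq_bot_iff)
  then have "AE y in lborel. u y = u x"
    by (rule AE_lborel_translate[rotated]) measurable
  then show ?thesis ..
qed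

text \<open>A change of variables moves the translation from the test function, where it is assumed
  to be invisible, onto \<open>u\<close>.\<close>

lemma AE_const_if_test_integrals_translation_invariant:
  fixes u :: "'a::euclidean_space \<Rightarrow> real"
  assumes meas [measurable]: "u \<in> borel_measurable borel" and u: "\<And>x. \<bar>u x\<bar> \<le> C"
    and inv: "\<And>\<psi> y. test_function \<psi> \<Longrightarrow> (LINT x|lborel. u x * \<psi> (x + y)) = (LINT x|lborel. u x * \<psi> x)"
  shows "\<exists>k. AE x in lborel. u x = k"
proof (rule AE_const_if_translation_invariant[OF meas])
  fix y
  show "AE x in lborel. u (x + y) = u x"
  proof (rule AE_eq_if_test_integrals_eq[OF _ meas u u])
    fix \<psi> :: "'a \<Rightarrow> real" assume \<psi>: "test_function \<psi>"
    have [measurable]: "\<psi> \<in> borel_measurable borel"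
      by (rule borel_measurable_continuous_onI[OF test_function_continuous[OF \<psi>]])
    show "(LINT x|lborel. u (x + y) * \<psi> x) = (LINT x|lborel. u x * \<psi> x)"
      using lborel_integral_translate[of "\<lambda>x. u x * \<psi> (x - y)" y] inv[OF \<psi>, of "- y"] by simp
  qed measurable
qed

text \<open>As \<open>u\<close> is only measurable, continuity has to come from
  \<open>\<psi>\<close>. Along a convergent sequence the translations stay bounded, so all
  translated supports lie in one ball and dominated convergence applies.\<close>

lemma continuous_test_integral:
  fixes u \<psi> :: "'a::euclidean_space \<Rightarrow> real"
  assumes [measurable]: "u \<in> borel_measurable borel" and u: "\<And>x. \<bar>u x\<bar> \<le> C"
    and \<psi>: "test_function \<psi>"
  shows "continuous_on UNIV (\<lambda>y. LINT x|lborel. u x * \<psi> (x + y))"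
proof -
  obtain K R where K: "\<And>x. \<bar>\<psi> x\<bar> \<le> K * indicator (cball 0 R) x"
    using test_function_bounded[OF \<psi>] by blast
  have cont: "continuous_on UNIV \<psi>"
    by (rule test_function_continuous[OF \<psi>])
  have [measurable]: "\<psi> \<in> borel_measurable borel"
    by (rule borel_measurable_continuous_onI[OF cont])
  have "C \<ge> 0"
    using u[of 0] by linarith
  have "(\<lambda>n. LINT x|lborel. u x * \<psi> (x + y n)) \<longlonglongrightarrow> (LINT x|lborel. u x * \<psi> (x + a))"
    if y: "y \<longlonglongrightarrow> a" for y a
  proof -
    obtain B where B: "\<And>n. norm (y n) \<le> B"
      using convergent_imp_Bseq[OF convergentI[OF y]] by (auto simp: Bseq_def)
    show ?thesis
    proof (rule integral_dominated_convergence)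
      show "integrable lborel (\<lambda>x. C * \<bar>K\<bar> * indicator (cball 0 (R + B)) x)"
        by (intro integrable_mult_right integrable_real_indicator emeasure_lborel_cball_finite) simp
      show "AE x in lborel. norm (u x * \<psi> (x + y n)) \<le> C * \<bar>K\<bar> * indicator (cball 0 (R + B)) x" for n
      proof (rule AE_I2)
        fix x
        have "\<bar>\<psi> (x + y n)\<bar> \<le> \<bar>K\<bar> * indicator (cball 0 (R + B)) x"
        proof (cases "x + y n \<in> cball 0 R")
          case True
          then have "norm x \<le> R + B"
            using norm_triangle_ineq4[of "x + y n" "y n"] B[of n] by simp
          with True K[of "x + y n"] show ?thesis by simp
        qed (use K[of "x + y n"] in simp)
        from mult_mono[OF u[of x] this \<open>C \<ge> 0\<close>]
        show "norm (u x * \<psi> (x + y n)) \<le> C * \<bar>K\<bar> * indicator (cball 0 (R + B)) x"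
          by (simp add: abs_mult mult.assoc)
      qed
      show "AE x in lborel. (\<lambda>n. u x * \<psi> (x + y n)) \<longlonglongrightarrow> u x * \<psi> (x + a)"
        using cont y by (intro AE_I2 tendsto_mult_left)
          (auto intro!: isCont_tendsto_compose[where g = \<psi>] tendsto_intros simp: continuous_on_eq_continuous_at)
    qed measurable
  qed
  then show ?thesis
    by (auto simp: continuous_on_sequentially o_def)
qed

lemma bounded_test_integral:
  fixes u \<psi> :: "'a::euclidean_space \<Rightarrow> real"
  assumes [measurable]: "u \<in> borel_measurable borel" and u: "\<And>x. \<bar>u x\<bar> \<le> C"
    and \<psi>: "test_function \<psi>"
  shows "\<bar>LINT x|lborel. u x * \<psi> (x + y)\<bar> \<le> C * (LINT x|lborel. \<bar>\<psi> x\<bar>)"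
proof -
  have [measurable]: "\<psi> \<in> borel_measurable borel"
    by (rule borel_measurable_continuous_onI[OF test_function_continuous[OF \<psi>]])
  have int: "integrable lborel (\<lambda>x. \<bar>\<psi> (x + y)\<bar>)"
    using test_function_times_integrable[of "\<lambda>_. 1" 1, OF _ _ test_function_translate[OF \<psi>, of y]] by simp
  have "\<bar>LINT x|lborel. u x * \<psi> (x + y)\<bar> \<le> (LINT x|lborel. C * \<bar>\<psi> (x + y)\<bar>)"
    using Bochner_Integration.integral_norm_bound_integral[OF test_function_times_integrable[OF assms(1) u test_function_translate[OF \<psi>, of y]], of "\<lambda>x. C * \<bar>\<psi> (x + y)\<bar>"] int u
    by (simp add: abs_mult mult_right_mono)
  also have "\<dots> = C * (LINT x|lborel. \<bar>\<psi> x\<bar>)"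
    using lborel_integral_translate[of "\<lambda>x. \<bar>\<psi> x\<bar>" y] by simp
  finally show ?thesis .
qed

section \<open>Bounded harmonic functions and Kronecker density\<close>

text \<open>The supremum \<open>M\<close> of the increments \<open>G\<close> need not be attained,
  so the maximum principle is used quantitatively: the deficit \<open>M - G\<close> grows at most by
  the factor \<open>N\<close>, the number of neighbours, in each step along
  \<open>s j\<close>.\<close>

lemma bounded_harmonic_increment_nonpos:
  fixes F :: "'a::real_vector \<Rightarrow> real" and s :: "'i::finite \<Rightarrow> 'a"
  assumes bounded: "\<And>x. \<bar>F x\<bar> \<le> K"
    and harmonic: "\<And>x. (\<Sum>i\<in>UNIV. (F (x + s i) - F x) + (F (x - s i) - F x)) = 0"
  shows "F (x + s j) - F x \<le> 0"
proof (rule ccontr)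
  define G where "G x = F (x + s j) - F x" for x
  define M where "M = (SUP x. G x)"
  define N where "N = 2 * real CARD('i)"
  assume "\<not> F (x + s j) - F x \<le> 0"
  then have "G x > 0" by (simp add: G_def)
  have G_bdd: "bdd_above (range G)"
  proof (rule bdd_aboveI2)
    show "G y \<le> 2 * K" for y
      using bounded[of y] bounded[of "y + s j"] by (simp add: G_def abs_le_iff)
  qed
  have G_le: "G y \<le> M" for y
    unfolding M_def by (rule cSUP_upper[OF UNIV_I G_bdd])
  have "M > 0"
    using \<open>G x > 0\<close> G_le[of x] by linarith
  have "N \<ge> 1"
    using zero_less_card_finite[where 'a = 'i] by (simp add: N_def del: zero_less_card_finite)
  have G_harmonic: "(\<Sum>i\<in>UNIV. (G (y + s i) - G y) + (G (y - s i) - G y)) = 0" for y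
    using harmonic[of y] harmonic[of "y + s j"]
    by (simp add: G_def sum.distrib sum_subtractf algebra_simps)
  have step: "M - G (y + s j) \<le> N * (M - G y)" for y
  proof -
    \<comment> \<open>All deficits are nonnegative, and by harmonicity those at the neighbours of
      \<open>y\<close> add up to \<open>N\<close> times the deficit at \<open>y\<close>; hence each
      single one is at most that large.\<close>
    have "M - G (y + s j) \<le> (M - G (y + s j)) + (M - G (y - s j))"
      using G_le by simp
    also have "\<dots> \<le> (\<Sum>i\<in>UNIV. (M - G (y + s i)) + (M - G (y - s i)))"
      by (rule member_le_sum) (simp_all only: finite UNIV_I add_nonneg_nonneg diff_ge_0_iff_ge G_le)
    also have "\<dots> = N * (M - G y)"
      using G_harmonic[of y] by (simp add: N_def sum.distrib sum_subtractf algebra_simps)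
    finally show ?thesis .
  qed
  have steps: "M - G (y + real k *\<^sub>R s j) \<le> N ^ k * (M - G y)" for y k
  proof (induction k)
    case (Suc k)
    have "y + real (Suc k) *\<^sub>R s j = (y + real k *\<^sub>R s j) + s j"
      by (simp add: algebra_simps)
    with step[of "y + real k *\<^sub>R s j"] mult_left_mono[OF Suc, of N] \<open>N \<ge> 1\<close> show ?case
      by (simp add: algebra_simps)
  qed simp
  \<comment> \<open>\<open>n\<close> increments of size at least \<open>M / 2\<close> exceed
    \<open>2 * K\<close>, the largest possible variation of \<open>F\<close>.\<close>
  obtain n :: nat where n: "real n * (M / 2) > 2 * K"
    using reals_Archimedean3[of "M / 2"] \<open>M > 0\<close> by (meson half_gt_zero)
  \<comment> \<open>The initial deficit is taken so small that even amplified by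
    \<open>N ^ n\<close> it stays at most \<open>M / 2\<close>.\<close>
  have "M - M / (2 * N ^ n) < M"
    using \<open>M > 0\<close> \<open>N \<ge> 1\<close> by simp
  then obtain y where y: "M - M / (2 * N ^ n) < G y"
    unfolding M_def using less_cSUP_iff[OF _ G_bdd] by auto
  have "G (y + real k *\<^sub>R s j) \<ge> M / 2" if "k < n" for k
  proof -
    have "N ^ k * (M - G y) \<le> N ^ n * (M - G y)"
      using that \<open>N \<ge> 1\<close> G_le[of y] by (intro mult_right_mono power_increasing) auto
    also have "\<dots> \<le> N ^ n * (M / (2 * N ^ n))"
      using y \<open>N \<ge> 1\<close> by (intro mult_left_mono) auto
    also have "\<dots> = M / 2"
      using \<open>N \<ge> 1\<close> by simp
    finally show ?thesis
      using steps[of y k] by simp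
  qed
  then have "(\<Sum>k<n. M / 2) \<le> (\<Sum>k<n. G (y + real k *\<^sub>R s j))"
    by (intro sum_mono) auto
  also have "\<dots> = (\<Sum>k<n. F (y + real (Suc k) *\<^sub>R s j) - F (y + real k *\<^sub>R s j))"
    by (simp add: G_def algebra_simps)
  also have "\<dots> = F (y + real n *\<^sub>R s j) - F y"
    by (subst sum_lessThan_telescope) simp
  also have "\<dots> \<le> 2 * K"
    using bounded[of y] bounded[of "y + real n *\<^sub>R s j"] by (simp add: abs_le_iff)
  finally show False
    using n by simp
qed

text \<open>Boundedness and harmonicity pass to \<open>- F\<close>, so the increments are
  nonpositive in both signs.\<close>

lemma bounded_harmonic_periodic:
  fixes F :: "'a::real_vector \<Rightarrow> real" and s :: "'i::finite \<Rightarrow> 'a"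
  assumes bounded: "\<And>x. \<bar>F x\<bar> \<le> K"
    and harmonic: "\<And>x. (\<Sum>i\<in>UNIV. (F (x + s i) - F x) + (F (x - s i) - F x)) = 0"
  shows "F (x + s j) = F x"
proof -
  have "(\<Sum>i\<in>UNIV. (- F (x + s i) - - F x) + (- F (x - s i) - - F x)) = 0" for x
    using harmonic[of x] by (simp add: sum.distrib sum_subtractf sum_negf)
  with bounded_harmonic_increment_nonpos[of "\<lambda>x. - F x" K s x j] bounded
  have "- F (x + s j) - - F x \<le> 0" by simp
  with bounded_harmonic_increment_nonpos[OF assms, of x j] show ?thesis by simp
qed

lemma periodic_of_int:
  fixes F :: "'a::real_vector \<Rightarrow> 'b"
  assumes "\<And>x. F (x + a) = F x"
  shows "F (x + of_int k *\<^sub>R a) = F x"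
proof (induction k arbitrary: x rule: int_induct[where k = 0])
  case (step1 i)
  show ?case using step1(2)[of "x + a"] assms[of x] by (simp add: algebra_simps)
next
  case (step2 i)
  show ?case using step2(2)[of "x - a"] assms[of "x - a"] by (simp add: algebra_simps)
qed simp

lemma periodic_sum_of_int:
  fixes F :: "'a::real_vector \<Rightarrow> 'b"
  assumes "\<And>x i. i \<in> I \<Longrightarrow> F (x + s i) = F x"
  shows "F (x + (\<Sum>i\<in>I. of_int (k i) *\<^sub>R s i)) = F x"
proof (cases "finite I")
  case True
  then show ?thesis
    using assms
  proof (induction I arbitrary: x)
    case (insert i I)
    then have "F (x + (\<Sum>i\<in>insert i I. of_int (k i) *\<^sub>R s i))
      = F ((x + of_int (k i) *\<^sub>R s i) + (\<Sum>i\<in>I. of_int (k i) *\<^sub>R s i))"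
      by (simp add: add.assoc)
    also have "\<dots> = F (x + of_int (k i) *\<^sub>R s i)"
      by (intro insert.IH insert.prems) auto
    also have "\<dots> = F x"
      by (intro periodic_of_int insert.prems) auto
    finally show ?case .
  qed simp
qed simp

section \<open>Rational independence and Kronecker's theorem\<close>

text \<open>An integer relation is in particular a rational one. This is the notion of independence
  over the ring of integers that \<open>Kronecker_thm_2\<close> requires.\<close>

lemma int_independent_if_rat_independent:
  assumes "rat_real.independent S"
  shows "module.independent (\<lambda>r (x::real). of_int r * x) S"
proof -
  interpret int_real: module "\<lambda>r (x::real). of_int r * x"
    by unfold_locales (simp_all add: algebra_simps)
  show ?thesis
  proof
    assume "int_real.dependent S"
    then obtain T u where T: "finite T" "T \<subseteq> S" "(\<Sum>v\<in>T. of_int (u v) * v) = 0" "\<exists>v\<in>T. u v \<noteq> 0"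
      by (auto simp: int_real.dependent_explicit)
    then have "(\<Sum>v\<in>T. of_rat (of_int (u v)) * v) = 0"
      by simp
    with T assms show False
      using rat_real.independentD[OF assms T(1,2), of "\<lambda>v. of_int (u v)"] by auto
  qed
qed

lemma kronecker_approx_vec:
  fixes c y :: "real ^ 'n"
  assumes "rat_independent_family (case_option 1 (\<lambda>i. c $ i))" and "\<epsilon> > 0"
  obtains k :: int and m :: "'n \<Rightarrow> int" where "\<And>i. \<bar>of_int k * c $ i - of_int (m i) - y $ i\<bar> < \<epsilon>"
proof -
  let ?n = "CARD('n)"
  obtain b :: "nat \<Rightarrow> 'n" where b: "bij_betw b {..<?n} UNIV"
    using ex_bij_betw_nat_finite[of "UNIV :: 'n set"] by (auto simp: atLeast0LessThan)
  define f where "f = case_option 1 (\<lambda>i. c $ i)"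
  \<comment> \<open>\<open>g\<close> numbers the index type by \<open>{..?n}\<close> and puts
    \<open>None\<close>, which carries the value 1, at the last index, where
    \<open>Kronecker_thm_2\<close> expects it.\<close>
  define g where "g i = (if i < ?n then Some (b i) else None)" for i
  have inj_g: "inj_on g {..?n}"
    using b by (auto simp: g_def inj_on_def bij_betw_def)
  have range_g: "g ` {..?n} = UNIV"
  proof -
    have "z \<in> g ` {..?n}" for z
    proof (cases z)
      case None
      then show ?thesis by (auto simp: g_def intro!: image_eqI[of _ _ ?n])
    next
      case (Some i)
      then obtain k where "k < ?n" "b k = i"
        using b by (metis UNIV_I bij_betw_def imageE lessThan_iff)
      with Some show ?thesis by (auto simp: g_def intro!: image_eqI[of _ _ k])
    qed
    then show ?thesis by auto
  qed
  have f: "inj f" "rat_real.independent (range f)"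
    using assms(1) by (auto simp: rat_independent_family_def f_def)
  have "module.independent (\<lambda>r (x::real). of_int r * x) ((f \<circ> g) ` {..?n})"
    using int_independent_if_rat_independent[OF f(2)] unfolding image_comp[symmetric] range_g .
  moreover have "inj_on (f \<circ> g) {..?n}"
    using inj_g f(1) by (meson comp_inj_on inj_on_subset subset_UNIV)
  moreover have "(f \<circ> g) ?n = 1"
    by (simp add: f_def g_def)
  ultimately obtain k m where
    km: "\<And>i. i < ?n \<Longrightarrow> \<bar>of_int k * (f \<circ> g) i - of_int (m i) - y $ b i\<bar> < \<epsilon>"
    using Kronecker_thm_2[of "f \<circ> g" ?n \<epsilon> "\<lambda>i. y $ b i"] \<open>\<epsilon> > 0\<close> by blast
  show thesis
  proof
    fix i
    have "inv_into {..<?n} b i < ?n" "b (inv_into {..<?n} b i) = i"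
      using b by (metis UNIV_I bij_betw_def inv_into_into lessThan_iff, metis UNIV_I bij_betw_inv_into_right)
    with km[of "inv_into {..<?n} b i"]
    show "\<bar>of_int k * c $ i - of_int ((m \<circ> inv_into {..<?n} b) i) - y $ i\<bar> < \<epsilon>"
      by (simp add: f_def g_def)
  qed
qed

lemma continuous_periodic_const:
  fixes c :: "real ^ 'n" and F :: "real ^ 'n \<Rightarrow> real"
  assumes ind: "rat_independent_family (case_option 1 (\<lambda>i. c $ i))"
    and cont: "continuous_on UNIV F"
    and c: "\<And>x. F (x + c) = F x" and axes: "\<And>x i. F (x + axis i 1) = F x"
  shows "F y = F 0"
proof (rule ccontr)
  assume "F y \<noteq> F 0"
  moreover have "isCont F y"
    using cont by (simp add: continuous_on_eq_continuous_at)
  \<comment> \<open>Within distance \<open>d\<close> of \<open>y\<close> the function is too close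
    to \<open>F y\<close> to take the value \<open>F 0\<close>; it suffices to find a group element
    there.\<close>
  ultimately obtain d where "d > 0" and d: "\<And>z. dist z y < d \<Longrightarrow> dist (F z) (F y) < dist (F y) (F 0)"
    unfolding continuous_at_eps_delta by (metis zero_less_dist_iff)
  \<comment> \<open>The norm is estimated by the sum of the coordinate errors, each less than
    \<open>\<epsilon>\<close>.\<close>
  define \<epsilon> where "\<epsilon> = d / CARD('n)"
  have "\<epsilon> > 0"
    using \<open>d > 0\<close> by (simp add: \<epsilon>_def)
  obtain k :: int and m :: "'n \<Rightarrow> int"
    where km: "\<And>i. \<bar>of_int k * c $ i - of_int (m i) - y $ i\<bar> < \<epsilon>"
    using kronecker_approx_vec[OF ind \<open>\<epsilon> > 0\<close>] by blast
  define z where "z = of_int k *\<^sub>R c + (\<Sum>i\<in>UNIV. of_int (- m i) *\<^sub>R axis i 1)"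
  have z_nth: "z $ i = of_int k * c $ i - of_int (m i)" for i
    by (simp add: z_def axis_def sum_negf if_distrib[of "\<lambda>x. _ * x"] cong: if_cong)
  have "norm (z - y) \<le> (\<Sum>i\<in>UNIV. \<bar>(z - y) $ i\<bar>)"
    by (rule norm_le_l1_cart)
  also have "\<dots> < (\<Sum>i\<in>(UNIV :: 'n set). \<epsilon>)"
    by (rule sum_strict_mono) (use km in \<open>auto simp: z_nth\<close>)
  also have "\<dots> = d"
    by (simp add: \<epsilon>_def)
  finally have "dist (F z) (F y) < dist (F y) (F 0)"
    by (intro d) (simp add: dist_norm)
  moreover have "F z = F 0"
    unfolding z_def
    using periodic_of_int[of F c 0 k, OF c] periodic_sum_of_int[of UNIV F "\<lambda>i. axis i 1" _ "\<lambda>i. - m i", OF axes]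
    by simp
  ultimately show False
    by (simp add: dist_commute)
qed

text \<open>Clear denominators in a rational relation and move the coefficient of 1 to the other
  side. If all coefficients of the \<open>c $ i\<close> vanished, the remaining one would vanish as
  well, making the relation trivial.\<close>

lemma int_relation_if_not_rat_independent:
  fixes c :: "real ^ 'n"
  assumes "\<not> rat_independent_family (case_option 1 (\<lambda>i. c $ i))"
  obtains m :: "'n \<Rightarrow> int" where "\<exists>i. m i \<noteq> 0" and "(\<Sum>i\<in>UNIV. of_int (m i) * c $ i) \<in> \<int>"
proof -
  obtain q :: "'n option \<Rightarrow> rat" and j where
    q: "(\<Sum>i\<in>UNIV. of_rat (q i) * case_option 1 (\<lambda>i. c $ i) i) = 0" and "q j \<noteq> 0"
    using assms unfolding rat_independent_family_iff by auto
  define D where "D = (\<Prod>i\<in>UNIV. snd (quotient_of (q i)))"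
  have "D > 0"
    by (auto simp: D_def intro!: prod_pos quotient_of_denom_pos')
  have "\<exists>n. of_int D * q i = of_int n" for i
  proof -
    obtain a b where ab: "quotient_of (q i) = (a, b)" by fastforce
    then have "b dvd D"
      unfolding D_def by (metis UNIV_I dvd_prodI finite snd_conv)
    then obtain e where "D = b * e" ..
    moreover have "b > 0" "q i = of_int a / of_int b"
      using ab quotient_of_denom_pos quotient_of_div by blast+
    ultimately have "of_int D * q i = of_int (e * a)"
      by simp
    then show ?thesis ..
  qed
  then obtain n where n: "\<And>i. of_int D * q i = of_int (n i)" by metis
  have n': "real_of_int D * of_rat (q i) = of_int (n i)" for i
    using arg_cong[OF n[of i], of "of_rat :: rat \<Rightarrow> real"] by (simp add: of_rat_mult)
  have "0 = real_of_int D * (\<Sum>i\<in>UNIV. of_rat (q i) * case_option 1 (\<lambda>i. c $ i) i)"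
    using q by simp
  also have "\<dots> = of_int (n None) + (\<Sum>i\<in>UNIV. of_int (n (Some i)) * c $ i)"
    by (simp add: UNIV_option_conv sum.reindex distrib_left sum_distrib_left mult.assoc[symmetric] n')
  finally have rel: "(\<Sum>i\<in>UNIV. of_int (n (Some i)) * c $ i) = of_int (- n None)"
    by simp
  have "n j \<noteq> 0"
    using n[of j] \<open>q j \<noteq> 0\<close> \<open>D > 0\<close> by auto
  have "\<exists>i. n (Some i) \<noteq> 0"
  proof (rule ccontr)
    assume "\<not> (\<exists>i. n (Some i) \<noteq> 0)"
    with rel \<open>n j \<noteq> 0\<close> show False by (cases j) auto
  qed
  with rel that[of "\<lambda>i. n (Some i)"] show thesis
    by (metis Ints_of_int)
qed

section \<open>The operator as a finite difference\<close>

text \<open>Summing over indices instead of over a set of vectors keeps multiplicities when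
  \<open>c\<close> is plus or minus a basis vector.\<close>

definition generator :: "real ^ 'n \<Rightarrow> 'n option \<Rightarrow> real ^ 'n" where
  "generator c = case_option c (\<lambda>i. axis i 1)"

lemma generator_simps [simp]: "generator c None = c" "generator c (Some i) = axis i 1"
  by (simp_all add: generator_def)

lemma generator_nonzero: "c \<noteq> 0 \<Longrightarrow> generator c j \<noteq> 0"
  by (cases j) (auto simp: axis_eq_0_iff)

lemma sum_UNIV_option:
  fixes f :: "'i::finite option \<Rightarrow> 'b::comm_monoid_add"
  shows "(\<Sum>j\<in>UNIV. f j) = f None + (\<Sum>i\<in>UNIV. f (Some i))"
  by (simp add: UNIV_option_conv sum.reindex)

lemma emeasure_mu_generator:
  fixes c :: "real ^ 'n"
  assumes "A \<in> sets punctured_borel"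
  shows "emeasure (mu c) A = (\<Sum>j\<in>UNIV. indicator A (generator c j) + indicator A (- generator c j))"
  using assms by (simp add: emeasure_mu sum_UNIV_option)

text \<open>The measure is carried by the finite set \<open>A\<close>, so the integral is a sum of
  point values times masses. The mass of a point counts the signed generators equal to it;
  exchanging the sums over points and indices therefore treats coinciding atoms correctly.\<close>

lemma levy_op_mu:
  fixes c :: "real ^ 'n"
  assumes "c \<noteq> 0" and \<psi>: "continuous_on UNIV \<psi>"
  shows "levy_op (mu c) \<psi> x =
    (\<Sum>j\<in>UNIV. (\<psi> (x + generator c j) - \<psi> x) + (\<psi> (x - generator c j) - \<psi> x))"
proof -
  define f where "f z = \<psi> (x + z) - \<psi> x" for z
  define A where "A = range (generator c) \<union> range (\<lambda>j. - generator c j)"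
  have f_indicator: "f a * indicator {a} z = (if a = z then f a else 0)" for a z
    by (simp add: indicator_def)
  have "finite A" by (simp add: A_def)
  have A: "generator c j \<in> A" "- generator c j \<in> A" for j
    by (auto simp: A_def)
  have "0 \<notin> A"
    using generator_nonzero[OF \<open>c \<noteq> 0\<close>] by (auto simp: A_def)
  have sing: "{a} \<in> sets (punctured_borel :: (real ^ 'n) measure)" if "a \<in> A" for a
    using that \<open>0 \<notin> A\<close> by (auto simp: sets_restrict_space image_iff intro!: bexI[of _ "{a}"])
  have [measurable]: "A \<in> sets (mu c)"
    using \<open>finite A\<close> \<open>0 \<notin> A\<close> by (auto simp: sets_restrict_space image_iff intro!: bexI[of _ A] borel_closed finite_imp_closed)
  have measure_sing: "measure (mu c) {a} = (\<Sum>j\<in>UNIV. indicator {a} (generator c j) + indicator {a} (- generator c j))"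
    if "a \<in> A" for a
  proof -
    have "emeasure (mu c) {a} = ennreal (\<Sum>j\<in>UNIV. indicator {a} (generator c j) + indicator {a} (- generator c j))"
      by (simp add: emeasure_mu_generator[OF sing[OF that]] sum_ennreal[symmetric] ennreal_indicator del: sum_ennreal)
    then show ?thesis
      by (simp add: measure_def sum_nonneg)
  qed
  have "f \<in> borel_measurable borel"
    unfolding f_def
    by (intro borel_measurable_continuous_onI continuous_on_diff continuous_on_compose2[OF \<psi>] continuous_on_add
        continuous_on_const continuous_on_id) auto
  then have f: "f \<in> borel_measurable (mu c)"
    by (subst measurable_cong_sets[OF sets_mu refl]) (rule measurable_restrict_space1)
  have "emeasure (mu c) (space (mu c) - A) = 0"
    using A sets.compl_sets[OF \<open>A \<in> sets (mu c)\<close>] by (subst emeasure_mu_generator) auto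
  then have "AE z in mu c. z \<in> A"
    by (intro AE_I[of _ _ "space (mu c) - A"]) (auto intro: sets.compl_sets[OF \<open>A \<in> sets (mu c)\<close>, simplified])
  then have "levy_op (mu c) \<psi> x = (LINT z|mu c. f z * indicator A z)"
    unfolding levy_op_def f_def[symmetric] by (intro integral_cong_AE) (use f in auto)
  also have "\<dots> = (\<Sum>a\<in>A. f a * measure (mu c) {a})"
  proof (rule integral_indicator_finite_real[OF \<open>finite A\<close>])
    show "emeasure (mu c) {a} < \<infinity>" if "a \<in> A" for a
      by (subst emeasure_mu_generator[OF sing[OF that]]) (auto simp: indicator_def)
  qed (use sing in simp)
  also have "\<dots> = (\<Sum>a\<in>A. \<Sum>j\<in>UNIV. (if a = generator c j then f a else 0) + (if a = - generator c j then f a else 0))"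
    by (simp add: measure_sing sum_distrib_left distrib_left f_indicator)
  also have "\<dots> = (\<Sum>j\<in>UNIV. f (generator c j) + f (- generator c j))"
    by (subst sum.swap) (simp add: sum.distrib \<open>finite A\<close> A)
  finally show ?thesis
    by (simp add: f_def)
qed

section \<open>Borel representatives and the weak equation\<close>

lemma L_infinity_borel_representative:
  fixes u :: "'a::euclidean_space \<Rightarrow> real"
  assumes "u \<in> L_infinity"
  obtains v C where "v \<in> borel_measurable borel" and "\<And>x. \<bar>v x\<bar> \<le> C" and "AE x in lborel. u x = v x"
proof -
  obtain C where u: "u \<in> borel_measurable (completion lborel)" "AE x in lborel. \<bar>u x\<bar> \<le> C"
    using assms by (auto simp: L_infinity_def AE_completion_iff)
  obtain g where g: "g \<in> borel_measurable lborel" "AE x in lborel. u x = g x"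
    using completion_ex_borel_measurable_real[OF u(1)] by blast
  show thesis
  proof
    \<comment> \<open>Truncation turns the almost-everywhere bound into a pointwise one and changes
      \<open>g\<close> only on a null set.\<close>
    show "(\<lambda>x. max (- \<bar>C\<bar>) (min \<bar>C\<bar> (g x))) \<in> borel_measurable borel"
      using g(1) by simp
    show "\<bar>max (- \<bar>C\<bar>) (min \<bar>C\<bar> (g x))\<bar> \<le> \<bar>C\<bar>" for x
      by (simp add: abs_le_iff)
    show "AE x in lborel. u x = max (- \<bar>C\<bar>) (min \<bar>C\<bar> (g x))"
      using u(2) g(2) by eventually_elim auto
  qed
qed

lemma lebesgue_integral_eq_lborel:
  fixes u v h :: "'a::euclidean_space \<Rightarrow> real"
  assumes u: "u \<in> borel_measurable lebesgue" and [measurable]: "v \<in> borel_measurable borel" "h \<in> borel_measurable borel"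
    and "AE x in lborel. u x = v x"
  shows "(LINT x|lebesgue. u x * h x) = (LINT x|lborel. v x * h x)"
proof -
  have borel: "f \<in> borel_measurable lebesgue" if "f \<in> borel_measurable borel" for f :: "'a \<Rightarrow> real"
    by (rule measurable_completion) (use that in simp)
  have "(LINT x|lebesgue. u x * h x) = (LINT x|lebesgue. v x * h x)"
    by (rule integral_cong_AE)
      (use assms(4) in \<open>auto simp: AE_completion_iff intro!: borel_measurable_times u borel[OF assms(2)] borel[OF assms(3)]\<close>)
  also have "\<dots> = (LINT x|lborel. v x * h x)"
    by (rule integral_completion) simp
  finally show ?thesis .
qed

text \<open>The weak equation tested with \<open>\<psi>\<close> thus says that \<open>F\<close> is
  harmonic at 0; other points are reached by translating \<open>\<psi>\<close>.\<close>

lemma levy_op_mu_integral: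
  fixes c :: "real ^ 'n"
  assumes "c \<noteq> 0" and v: "v \<in> borel_measurable borel" "\<And>x. \<bar>v x\<bar> \<le> C" and \<psi>: "test_function \<psi>"
  defines "F y \<equiv> LINT x|lborel. v x * \<psi> (x + y)"
  shows "(LINT x|lborel. v x * levy_op (mu c) \<psi> x)
    = (\<Sum>j\<in>UNIV. (F (generator c j) - F 0) + (F (- generator c j) - F 0))"
proof -
  have int: "integrable lborel (\<lambda>x. v x * \<psi> (x + y))" for y
    by (rule test_function_times_integrable[OF v test_function_translate[OF \<psi>]])
  \<comment> \<open>Writing \<open>x + 0\<close> keeps every summand an instance of
    \<open>int\<close>, so that the integral can be split by rewriting alone.\<close>
  have "(LINT x|lborel. v x * levy_op (mu c) \<psi> x) = (LINT x|lborel. (\<Sum>j\<in>UNIV.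
      (v x * \<psi> (x + generator c j) - v x * \<psi> (x + 0)) + (v x * \<psi> (x + - generator c j) - v x * \<psi> (x + 0))))"
    by (simp add: levy_op_mu[OF \<open>c \<noteq> 0\<close> test_function_continuous[OF \<psi>]] sum_distrib_left algebra_simps)
  also have "\<dots> = (\<Sum>j\<in>UNIV. (F (generator c j) - F 0) + (F (- generator c j) - F 0))"
    unfolding F_def by (simp only: Bochner_Integration.integral_sum Bochner_Integration.integral_add Bochner_Integration.integral_diff
        Bochner_Integration.integrable_diff Bochner_Integration.integrable_add int)
  finally show ?thesis .
qed

lemma borel_measurable_levy_op_mu:
  fixes c :: "real ^ 'n"
  assumes "c \<noteq> 0" and \<psi>: "test_function \<psi>"
  shows "levy_op (mu c) \<psi> \<in> borel_measurable borel"
proof -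
  have [measurable]: "\<psi> \<in> borel_measurable borel"
    by (rule borel_measurable_continuous_onI[OF test_function_continuous[OF \<psi>]])
  show ?thesis
    unfolding levy_op_mu[OF \<open>c \<noteq> 0\<close> test_function_continuous[OF \<psi>], abs_def] by measurable
qed

section \<open>The two implications\<close>

lemma liouville_if_rat_independent:
  fixes c :: "real ^ 'n"
  assumes "c \<noteq> 0" and ind: "rat_independent_family (case_option 1 (\<lambda>i. c $ i))"
  shows "liouville_property (mu c)"
  unfolding liouville_property_def
proof (intro ballI impI)
  fix u :: "real ^ 'n \<Rightarrow> real"
  assume u: "u \<in> L_infinity" and zero: "levy_op_zero_distr (mu c) u"
  obtain v C where v: "v \<in> borel_measurable borel" "\<And>x. \<bar>v x\<bar> \<le> C" and uv: "AE x in lborel. u x = v x"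
    using L_infinity_borel_representative[OF u] by blast
  have v_zero: "(LINT x|lborel. v x * levy_op (mu c) \<psi> x) = 0" if "test_function \<psi>" for \<psi>
    using zero that lebesgue_integral_eq_lborel[OF _ v(1) borel_measurable_levy_op_mu[OF \<open>c \<noteq> 0\<close> that] uv] u
    by (simp add: levy_op_zero_distr_def L_infinity_def)
  have "\<exists>k. AE x in lborel. v x = k"
  proof (rule AE_const_if_test_integrals_translation_invariant[OF v])
    fix \<psi> :: "real ^ 'n \<Rightarrow> real" and y
    assume \<psi>: "test_function \<psi>"
    define F where "F y = (LINT x|lborel. v x * \<psi> (x + y))" for y
    \<comment> \<open>Testing with the translate of \<open>\<psi>\<close> by \<open>y\<close> moves
      harmonicity from 0 to \<open>y\<close>.\<close>
    have "(\<Sum>j\<in>UNIV. (F (y + generator c j) - F y) + (F (y - generator c j) - F y)) = 0" for y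
      using levy_op_mu_integral[OF \<open>c \<noteq> 0\<close> v test_function_translate[OF \<psi>, of y]]
        v_zero[OF test_function_translate[OF \<psi>, of y]]
      by (simp add: F_def algebra_simps)
    moreover have "\<bar>F y\<bar> \<le> C * (LINT x|lborel. \<bar>\<psi> x\<bar>)" for y
      unfolding F_def by (rule bounded_test_integral[OF v \<psi>])
    ultimately have per: "F (y + generator c j) = F y" for y j
      by (intro bounded_harmonic_periodic)
    have "F y = F 0"
    proof (rule continuous_periodic_const[OF ind])
      show "continuous_on UNIV F"
        unfolding F_def by (rule continuous_test_integral[OF v \<psi>])
      show "F (x + c) = F x" "F (x + axis i 1) = F x" for x i
        using per[of x None] per[of x "Some i"] by simp_all
    qed
    then show "(LINT x|lborel. v x * \<psi> (x + y)) = (LINT x|lborel. v x * \<psi> x)"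
      by (simp add: F_def)
  qed
  then obtain k where "AE x in lborel. v x = k" ..
  with uv have "AE x in lborel. u x = k"
    by eventually_elim simp
  then show "\<exists>k. AE x in lebesgue. u x = k"
    by (auto simp: AE_completion_iff)
qed

text \<open>The set where \<open>u\<close> differs from \<open>k\<close> is open and negligible,
  hence empty.\<close>

lemma continuous_AE_const_imp_const:
  fixes u :: "'a::euclidean_space \<Rightarrow> real"
  assumes "continuous_on UNIV u" and "AE x in lebesgue. u x = k"
  shows "u x = k"
proof -
  have "open {x. u x \<noteq> k}"
    using assms(1) by (intro open_Collect_neq continuous_on_const)
  moreover have "negligible {x. u x \<noteq> k}"
    using assms(2) by (auto simp: negligible_iff_null_sets eventually_ae_filter intro: null_sets_completion_subset)
  ultimately show ?thesis
    using open_not_negligible by blast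
qed

text \<open>The additive map \<open>p\<close> takes integer values on all generators, so
  \<open>u\<close> has each of them as a period and every finite difference pairs to zero with
  \<open>u\<close>.\<close>

lemma not_liouville_if_int_relation:
  fixes c :: "real ^ 'n" and m :: "'n \<Rightarrow> int"
  assumes "c \<noteq> 0" and "m i \<noteq> 0" and rel: "(\<Sum>i\<in>UNIV. of_int (m i) * c $ i) \<in> \<int>"
  shows "\<not> liouville_property (mu c)"
proof
  define p where "p x = (\<Sum>i\<in>UNIV. of_int (m i) * x $ i)" for x :: "real ^ 'n"
  define u where "u x = cos (2 * pi * p x)" for x :: "real ^ 'n"
  have p_add: "p (x + y) = p x + p y" for x y
    by (simp add: p_def distrib_left sum.distrib)
  have p_axis: "p (axis j t) = of_int (m j) * t" for j t
    by (simp add: p_def axis_def if_distrib[of "\<lambda>x. _ * x"] cong: if_cong)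
  have p_gen: "p (generator c j) \<in> \<int>" for j
    using rel by (cases j) (simp_all add: p_axis, simp add: p_def)
  have u_per: "u (x + generator c j) = u x" for x j
  proof -
    obtain n where "p (generator c j) = of_int n"
      using p_gen[of j] by (elim Ints_cases)
    then have "2 * pi * p (x + generator c j) = 2 * pi * p x + 2 * pi * of_int n"
      by (simp add: p_add algebra_simps)
    then show ?thesis
      by (simp add: u_def cos_add)
  qed
  have cont: "continuous_on UNIV u"
    unfolding u_def p_def by (intro continuous_intros)
  have [measurable]: "u \<in> borel_measurable borel"
    by (rule borel_measurable_continuous_onI[OF cont])
  have u_bdd: "\<bar>u x\<bar> \<le> 1" for x
    by (simp add: u_def)
  have u_leb: "u \<in> borel_measurable lebesgue"
    by (rule measurable_completion) simp
  have u_Linf: "u \<in> L_infinity"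
    using u_bdd u_leb by (auto simp: L_infinity_def intro!: exI[of _ 1])
  have "levy_op_zero_distr (mu c) u"
    unfolding levy_op_zero_distr_def
  proof (intro allI impI)
    fix \<psi> :: "real ^ 'n \<Rightarrow> real"
    assume \<psi>: "test_function \<psi>"
    have [measurable]: "\<psi> \<in> borel_measurable borel"
      by (rule borel_measurable_continuous_onI[OF test_function_continuous[OF \<psi>]])
    \<comment> \<open>Translating by a period leaves \<open>u\<close> unchanged and moves only the
      test function; for the negative generator the already shifted integrand is translated
      back.\<close>
    have shift: "(LINT x|lborel. u x * \<psi> (x + generator c j)) = (LINT x|lborel. u x * \<psi> x)"
      "(LINT x|lborel. u x * \<psi> (x + - generator c j)) = (LINT x|lborel. u x * \<psi> x)" for j
      using lborel_integral_translate[of "\<lambda>x. u x * \<psi> x" "generator c j"]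
        lborel_integral_translate[of "\<lambda>x. u x * \<psi> (x + - generator c j)" "generator c j"]
      by (simp_all add: u_per)
    have "(LINT x|lebesgue. u x * levy_op (mu c) \<psi> x) = (LINT x|lborel. u x * levy_op (mu c) \<psi> x)"
      by (rule lebesgue_integral_eq_lborel[OF u_leb _ borel_measurable_levy_op_mu[OF \<open>c \<noteq> 0\<close> \<psi>]]) auto
    also have "\<dots> = 0"
      by (subst levy_op_mu_integral[OF \<open>c \<noteq> 0\<close> _ u_bdd \<psi>]) (simp_all add: shift[simplified])
    finally show "(LINT x|lebesgue. u x * levy_op (mu c) \<psi> x) = 0" .
  qed
  moreover assume "liouville_property (mu c)"
  ultimately obtain k where "AE x in lebesgue. u x = k"
    using u_Linf by (auto simp: liouville_property_def)
  then have const: "u x = k" for x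
    by (rule continuous_AE_const_imp_const[OF cont])
  have "u 0 = 1"
    by (simp add: u_def p_def)
  \<comment> \<open>At this point \<open>p\<close> equals 1/2, so the cosine is evaluated at
    \<open>pi\<close>.\<close>
  moreover have "u (axis i (1 / (2 * of_int (m i)))) = - 1"
    using \<open>m i \<noteq> 0\<close> by (simp add: u_def p_axis)
  ultimately show False
    using const by (metis one_neq_neg_one)
qed

theorem corollary5p7:
  fixes c :: "real ^ 'n"
  assumes "c \<noteq> 0"
  shows "liouville_property (mu c) \<longleftrightarrow>
    rat_independent_family (case_option 1 (\<lambda>i :: 'n. c $ i))"
  using assms liouville_if_rat_independent not_liouville_if_int_relation int_relation_if_not_rat_independent
  by metis

end
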